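(* As $n \to \infty$, $$V(n) \leq \frac{117}{2192}\, n^2 (1+o(1)).$$ That is, there is a sequence of real numbers $\varepsilon_n \to 0$ such that $V(n) \le \frac{117}{2192} n^2(1+\varepsilon_n)$ for all positive integers $n$.
   Context: For a positive integer $n$, write $[1,n]=\{1,2,\dots,n\}$. A $2$-coloring of $[1,n]$ is a function $\chi:[1,n]\to\{0,1\}$. A $3$-term arithmetic progression in $[1,n]$ is a triple $a, a+d, a+2d$ of elements of $[1,n]$ with $d\ge 1$ (so progressions are unordered, and there are $\frac{n^2}{4}(1+o(1))$ of them); it is monochromatic under $\chi$ if $\chi(a)=\chi(a+d)=\chi(a+2d)$. $V(n)$ denotes the minimum, over all $2$-colorings $\chi$ of $[1,n]$, of the number of $3$-term arithmetic progressions in $[1,n]$ that are monochromatic under $\chi$. *)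

theory Defs
  imports Complex_Main "HOL-Library.FuncSet"
begin

(* Colorings are extensional (undefined outside {1..n}), so that there are exactly 2 ^ n of
   them; the set of colorings is finite and nonempty, and the minimum below is attained. *)
definition colorings :: "nat \<Rightarrow> (nat \<Rightarrow> nat) set" where
  "colorings n = {1..n} \<rightarrow>\<^sub>E {0, 1}"

(* d \<ge> 1: each progression is counted once, as an increasing triple. *)
definition three_aps :: "nat \<Rightarrow> (nat \<times> nat \<times> nat) set" where
  "three_aps n = {(a, a + d, a + 2 * d) | a d.
     d \<ge> 1 \<and> a \<in> {1..n} \<and> a + d \<in> {1..n} \<and> a + 2 * d \<in> {1..n}}"

definition mono_aps :: "nat \<Rightarrow> (nat \<Rightarrow> nat) \<Rightarrow> (nat \<times> nat \<times> nat) set" where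
  "mono_aps n \<chi> = {(x, y, z) \<in> three_aps n. \<chi> x = \<chi> y \<and> \<chi> y = \<chi> z}"

definition V :: "nat \<Rightarrow> nat" where
  "V n = Min ((\<lambda>\<chi>. card (mono_aps n \<chi>)) ` colorings n)"

lemma finite_colorings: "finite (colorings n)"
  unfolding colorings_def by (intro finite_PiE) auto

lemma colorings_nonempty: "colorings n \<noteq> {}"
  unfolding colorings_def by (simp add: PiE_eq_empty_iff)

lemma finite_three_aps: "finite (three_aps n)"
  by (rule finite_subset[of _ "{1..n} \<times> {1..n} \<times> {1..n}"]) (auto simp: three_aps_def)

end

theory Submission
  imports Defs
begin

text \<open>
  Encode a coloring by a function \<open>f\<close> with values \<open>1\<close> and \<open>-1\<close>. For three signs,
  \<open>1 + f x * f y + f y * f z + f x * f z\<close> is \<open>4\<close> when they agree and \<open>0\<close> otherwise, so with two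
  colors the number of monochromatic triples is determined by correlations of pairs. A progression
  is determined by its two endpoints, which range over the pairs of equal parity. If \<open>f\<close> is
  antisymmetric under reflection of the interval and constant on consecutive pairs of positions, it
  sums to zero over each parity class, so the correlation of the two endpoints vanishes. The
  correlation of the midpoint \<open>y\<close> with an endpoint is a sum of \<open>f\<close> over the largest window centered
  at \<open>y\<close> that fits into the interval; by antisymmetry only \<open>y\<close> in the left half matters, where the
  window begins at \<open>1\<close> and the sum is a prefix sum. Hence the count reduces to the one-dimensional
  sum of \<open>f y\<close> times the sum of \<open>f\<close> over \<open>{1..<2 * y}\<close> (\<open>card_mono_aps_antisymmetric\<close>), and
  an antisymmetric coloring beats the random one when this sum is negative.

  Blowing up a fixed sign pattern on \<open>2 * l\<close> cells, each cell becoming a block of \<open>2 * k\<close> equal signs,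
  makes the sum \<open>k\<^sup>2\<close> times a number depending on the pattern alone, up to an error linear in \<open>k\<close>
  (\<open>sum_doubled_prefix_le\<close>). The error is at most the number of degenerate triples \<open>x = y = z\<close>,
  which have to be subtracted anyway, so the resulting bound \<open>V_block_le\<close> has no lower-order term.

  It remains to find a good pattern. On \<open>548\<close> cells, twelve blocks of lengths 28, 6, 28, 37, 59, 116,
  116, 59, 37, 28, 6, 28 with alternating signs give the number \<open>-21920\<close>, and
  \<open>(2 * 274\<^sup>2 - 21920) / 2 = 64116 = 117 / 2192 * 1096\<^sup>2\<close>. So the bound holds without error term
  when \<open>n\<close> is a multiple of \<open>1096\<close>. As \<open>V\<close> is monotone, rounding \<open>n\<close> up to such a multiple
  costs only a factor \<open>(1 + 1096 / n)\<^sup>2\<close>.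
\<close>

section \<open>Counting monochromatic progressions of an antisymmetric coloring\<close>

definition sign_coloring :: "nat \<Rightarrow> (nat \<Rightarrow> int) \<Rightarrow> nat \<Rightarrow> nat" where
  "sign_coloring n f = (\<lambda>i\<in>{1..n}. if f i = 1 then 1 else 0)"

lemma sign_coloring_in_colorings: "sign_coloring n f \<in> colorings n"
  unfolding sign_coloring_def colorings_def by auto

text \<open>
  The pairs of endpoints of progressions, in both orders and with the degenerate pairs on the
  diagonal: keeping these makes the sums below factor.
\<close>
definition same_parity_pairs :: "nat \<Rightarrow> (nat \<times> nat) set" where
  "same_parity_pairs n = {(x, z) \<in> {1..n} \<times> {1..n}. even (x + z)}"

lemma finite_same_parity_pairs: "finite (same_parity_pairs n)"
  unfolding same_parity_pairs_def by (rule finite_subset[of _ "{1..n} \<times> {1..n}"]) auto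

lemma sum_same_parity_pairs:
  fixes g :: "nat \<times> nat \<Rightarrow> 'a::comm_monoid_add"
  shows "(\<Sum>p\<in>same_parity_pairs n. g p) = (\<Sum>x\<in>{1..n}. \<Sum>z | z \<in> {1..n} \<and> even (x + z). g (x, z))"
proof -
  have "same_parity_pairs n = Sigma {1..n} (\<lambda>x. {z. z \<in> {1..n} \<and> even (x + z)})"
    unfolding same_parity_pairs_def by auto
  then show ?thesis by (simp add: sum.Sigma)
qed

text \<open>
  Each parity class is indexed by the \<open>h\<close> consecutive pairs \<open>2 * i + 1\<close>, \<open>2 * i + 2\<close>, so that a
  function constant on these pairs has the same sum over both classes.
\<close>
lemma sum_parity_class:
  fixes g :: "nat \<Rightarrow> 'a::comm_monoid_add"
  shows "(\<Sum>z | z \<in> {1..2 * h} \<and> even (x + z). g z)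
    = (\<Sum>i<h. g (if even x then 2 * i + 2 else 2 * i + 1))"
proof (induction h)
  case (Suc h)
  let ?w = "if even x then 2 * h + 2 else 2 * h + 1"
  have "{z. z \<in> {1..2 * Suc h} \<and> even (x + z)} = insert ?w {z. z \<in> {1..2 * h} \<and> even (x + z)}"
    by (auto simp: le_Suc_eq)
  moreover have "?w \<notin> {z. z \<in> {1..2 * h} \<and> even (x + z)}" by auto
  ultimately show ?case using Suc by (simp add: add.commute)
qed simp

text \<open>
  The diagonal contributes \<open>n\<close>, and every progression is seen twice, once from each end.
\<close>
lemma card_monochromatic_pairs:
  assumes pm: "\<And>i. i \<in> {1..n} \<Longrightarrow> f i = 1 \<or> f i = - 1"
  shows "card {(x, z) \<in> same_parity_pairs n. f x = f ((x + z) div 2) \<and> f ((x + z) div 2) = f z}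
    = n + 2 * card (mono_aps n (sign_coloring n f))"
proof -
  define M where
    "M = {(x, z) \<in> same_parity_pairs n. f x = f ((x + z) div 2) \<and> f ((x + z) div 2) = f z}"
  let ?lt = "{(x, z) \<in> M. x < z}" and ?gt = "{(x, z) \<in> M. z < x}" and ?eq = "{(x, z) \<in> M. x = z}"
  have fin: "finite M"
    unfolding M_def by (rule finite_subset[OF _ finite_same_parity_pairs]) auto
  have color_eq: "sign_coloring n f i = sign_coloring n f j \<longleftrightarrow> f i = f j"
    if "i \<in> {1..n}" "j \<in> {1..n}" for i j
    using pm[OF that(1)] pm[OF that(2)] that unfolding sign_coloring_def by auto
  have "bij_betw (\<lambda>(x, y, z). (x, z)) (mono_aps n (sign_coloring n f)) ?lt"
  proof (rule bij_betw_byWitness[where f' = "\<lambda>(x, z). (x, (x + z) div 2, z)"])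
    show "(\<lambda>(x, y, z). (x, z)) ` mono_aps n (sign_coloring n f) \<subseteq> ?lt"
    proof (rule image_subsetI)
      fix p assume p: "p \<in> mono_aps n (sign_coloring n f)"
      then obtain a d where ad: "p = (a, a + d, a + 2 * d)" "d \<ge> 1"
          "a \<in> {1..n}" "a + d \<in> {1..n}" "a + 2 * d \<in> {1..n}"
        unfolding mono_aps_def three_aps_def by auto
      then have "f a = f (a + d)" "f (a + d) = f (a + 2 * d)"
        using p by (auto simp: mono_aps_def color_eq)
      moreover have "(a + (a + 2 * d)) div 2 = a + d" by simp
      ultimately have "(a, a + 2 * d) \<in> M"
        using ad unfolding M_def same_parity_pairs_def by auto
      then show "(\<lambda>(x, y, z). (x, z)) p \<in> ?lt" using ad by simp
    qed
    show "(\<lambda>(x, z). (x, (x + z) div 2, z)) ` ?lt \<subseteq> mono_aps n (sign_coloring n f)"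
    proof clarify
      fix x z assume "(x, z) \<in> M" and lt: "x < z"
      then have x: "x \<in> {1..n}" and z: "z \<in> {1..n}" and "even (x + z)"
        and c: "f x = f ((x + z) div 2)" "f ((x + z) div 2) = f z"
        unfolding M_def same_parity_pairs_def by auto
      then have "even (z - x)" using lt by simp
      then obtain d where d: "z - x = 2 * d" by (elim evenE)
      have z': "z = x + 2 * d" using d lt by simp
      have mid: "(x + z) div 2 = x + d" unfolding z' by simp
      have m: "x + d \<in> {1..n}" using x z z' by auto
      have "(x, x + d, z) \<in> three_aps n"
        using x z m lt unfolding three_aps_def z' by auto
      then show "(x, (x + z) div 2, z) \<in> mono_aps n (sign_coloring n f)"
        using c x z m unfolding mono_aps_def mid by (auto simp: color_eq)
    qed
  qed (auto simp: mono_aps_def three_aps_def)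
  then have lt: "card ?lt = card (mono_aps n (sign_coloring n f))"
    by (rule bij_betw_same_card[symmetric])
  have "bij_betw prod.swap ?lt ?gt"
    by (rule bij_betw_byWitness[where f' = prod.swap])
      (auto simp: M_def same_parity_pairs_def add.commute)
  then have gt: "card ?gt = card ?lt"
    by (rule bij_betw_same_card[symmetric])
  have "?eq = (\<lambda>x. (x, x)) ` {1..n}"
    unfolding M_def same_parity_pairs_def by auto
  then have eq: "card ?eq = n" by (simp add: card_image inj_on_def)
  have "M = ?eq \<union> (?lt \<union> ?gt)" by auto
  then have "card M = card (?eq \<union> (?lt \<union> ?gt))" by simp
  also have "\<dots> = card ?eq + card (?lt \<union> ?gt)"
    by (rule card_Un_disjoint) (auto intro: finite_subset[OF _ fin])
  also have "card (?lt \<union> ?gt) = card ?lt + card ?gt"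
    by (rule card_Un_disjoint) (auto intro: finite_subset[OF _ fin])
  finally show ?thesis using lt gt eq unfolding M_def by simp
qed

text \<open>
  Reflection exchanges odd and even positions and changes the sign, while constancy on pairs makes
  the odd and the even sum equal; so the sum is its own negative.
\<close>
lemma sum_odd_positions_eq_0:
  fixes f :: "nat \<Rightarrow> int"
  assumes anti: "\<And>i. i \<in> {1..2 * h} \<Longrightarrow> f (2 * h + 1 - i) = - f i"
    and pairs: "\<And>i. i < h \<Longrightarrow> f (2 * i + 1) = f (2 * i + 2)"
  shows "(\<Sum>i<h. f (2 * i + 1)) = 0"
proof -
  have "(\<Sum>i<h. f (2 * i + 1)) = (\<Sum>i<h. f (2 * (h - Suc i) + 1))"
    by (rule sum.nat_diff_reindex[symmetric])
  also have "\<dots> = (\<Sum>i<h. - f (2 * i + 2))"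
  proof (rule sum.cong[OF refl])
    fix i assume "i \<in> {..<h}"
    then have "2 * (h - Suc i) + 1 = 2 * h + 1 - (2 * i + 2)" "2 * i + 2 \<in> {1..2 * h}" by auto
    then show "f (2 * (h - Suc i) + 1) = - f (2 * i + 2)" using anti by metis
  qed
  also have "\<dots> = - (\<Sum>i<h. f (2 * i + 1))" using pairs by (simp add: sum_negf)
  finally show ?thesis by simp
qed

text \<open>
  For a fixed midpoint \<open>y\<close> the endpoint \<open>x\<close> runs through the window of all positions whose reflection
  in \<open>y\<close> stays inside the interval. For \<open>y\<close> in the left half this window is \<open>{1..<2 * y}\<close>. Reflecting
  the interval changes the sign of both \<open>f y\<close> and the window sum, so the right half contributes
  the same amount again.
\<close>
lemma sum_midpoint_products:
  fixes f :: "nat \<Rightarrow> int"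
  assumes anti: "\<And>i. i \<in> {1..2 * h} \<Longrightarrow> f (2 * h + 1 - i) = - f i"
  shows "(\<Sum>(x, z)\<in>same_parity_pairs (2 * h). f ((x + z) div 2) * f x)
    = 2 * (\<Sum>y\<in>{1..h}. f y * (\<Sum>x\<in>{1..<2 * y}. f x))"
proof -
  let ?n = "2 * h"
  define W where "W y = {x \<in> {1..?n}. 2 * y - x \<in> {1..?n}}" for y
  define T where "T y = f y * (\<Sum>x\<in>W y. f x)" for y
  have "(\<Sum>(x, z)\<in>same_parity_pairs ?n. f ((x + z) div 2) * f x)
      = (\<Sum>(y, x)\<in>Sigma {1..?n} W. f y * f x)"
  proof (rule sum.reindex_bij_witness[where i = "\<lambda>(y, x). (x, 2 * y - x)"
        and j = "\<lambda>(x, z). ((x + z) div 2, x)"])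
    fix p assume "p \<in> same_parity_pairs ?n"
    then obtain x z where p: "p = (x, z)" "x \<in> {1..?n}" "z \<in> {1..?n}" "even (x + z)"
      unfolding same_parity_pairs_def by auto
    from p(4) obtain y where y: "x + z = 2 * y" by (elim evenE)
    then have *: "(x + z) div 2 = y" "z = 2 * y - x" "y \<in> {1..?n}" using p by auto
    show "(\<lambda>(y, x). (x, 2 * y - x)) ((\<lambda>(x, z). ((x + z) div 2, x)) p) = p"
      using * p by simp
    show "(\<lambda>(x, z). ((x + z) div 2, x)) p \<in> Sigma {1..?n} W"
      using * p unfolding W_def by auto
    show "(case (\<lambda>(x, z). ((x + z) div 2, x)) p of (y, x) \<Rightarrow> f y * f x)
        = (case p of (x, z) \<Rightarrow> f ((x + z) div 2) * f x)"
      using p by simp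
  qed (auto simp: W_def same_parity_pairs_def)
  also have "\<dots> = (\<Sum>y\<in>{1..?n}. T y)"
    unfolding T_def W_def by (simp add: sum.Sigma sum_distrib_left)
  also have "\<dots> = (\<Sum>y\<in>{1..h}. T y) + (\<Sum>y\<in>{h + 1..?n}. T y)"
    using sum.ub_add_nat[of 1 h T h] by (simp add: mult_2)
  also have "(\<Sum>y\<in>{h + 1..?n}. T y) = (\<Sum>y\<in>{1..h}. T y)"
  proof (rule sum.reindex_bij_witness[where i = "\<lambda>y. ?n + 1 - y" and j = "\<lambda>y. ?n + 1 - y"])
    fix y assume y: "y \<in> {h + 1..?n}"
    have "(\<Sum>x\<in>W (?n + 1 - y). f x) = (\<Sum>x\<in>W y. - f x)"
    proof (rule sum.reindex_bij_witness[where i = "\<lambda>x. ?n + 1 - x" and j = "\<lambda>x. ?n + 1 - x"])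
      fix x assume x: "x \<in> W (?n + 1 - y)"
      then have "x \<in> {1..?n}" unfolding W_def by auto
      then show "- f (?n + 1 - x) = f x" using anti by simp
    qed (use y in \<open>auto simp: W_def\<close>)
    moreover have "f (?n + 1 - y) = - f y" using y by (intro anti) auto
    ultimately show "T (?n + 1 - y) = T y" unfolding T_def by (simp add: sum_negf)
  qed auto
  also have "(\<Sum>y\<in>{1..h}. T y) = (\<Sum>y\<in>{1..h}. f y * (\<Sum>x\<in>{1..<2 * y}. f x))"
  proof (rule sum.cong[OF refl])
    fix y assume "y \<in> {1..h}"
    then have "W y = {1..<2 * y}" unfolding W_def by auto
    then show "T y = f y * (\<Sum>x\<in>{1..<2 * y}. f x)" unfolding T_def by simp
  qed
  finally show ?thesis by simp
qed

text \<open>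
  Summing \<open>1 + f x * f z + f y * f x + f y * f z\<close> over all pairs of endpoints counts every
  monochromatic pair four times. The constant term gives the number of pairs, the term
  \<open>f x * f z\<close> cancels, and the two midpoint terms agree by the symmetry in \<open>x\<close> and \<open>z\<close>.
\<close>
lemma card_mono_aps_antisymmetric:
  fixes f :: "nat \<Rightarrow> int"
  assumes pm: "\<And>i. i \<in> {1..2 * h} \<Longrightarrow> f i = 1 \<or> f i = - 1"
    and anti: "\<And>i. i \<in> {1..2 * h} \<Longrightarrow> f (2 * h + 1 - i) = - f i"
    and pairs: "\<And>i. i < h \<Longrightarrow> f (2 * i + 1) = f (2 * i + 2)"
  shows "4 * int (card (mono_aps (2 * h) (sign_coloring (2 * h) f))) + 4 * int h
    = (int h)\<^sup>2 + 2 * (\<Sum>y\<in>{1..h}. f y * (\<Sum>x\<in>{1..<2 * y}. f x))"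
proof -
  let ?n = "2 * h"
  let ?P = "same_parity_pairs ?n"
  let ?mono = "\<lambda>(x, z). f x = f ((x + z) div 2) \<and> f ((x + z) div 2) = f z"
  let ?S = "\<Sum>y\<in>{1..h}. f y * (\<Sum>x\<in>{1..<2 * y}. f x)"
  have "4 * (int ?n + 2 * int (card (mono_aps ?n (sign_coloring ?n f)))) = 4 * int (card {p \<in> ?P. ?mono p})"
    using card_monochromatic_pairs[of ?n f, OF pm] by (simp add: case_prod_unfold)
  also have "\<dots> = (\<Sum>p\<in>?P. if ?mono p then 4 else 0)"
    by (simp add: finite_same_parity_pairs sum.If_cases Int_def conj_commute)
  also have "\<dots> = (\<Sum>(x, z)\<in>?P. 1 + f x * f z + f ((x + z) div 2) * f x + f ((x + z) div 2) * f z)"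
  proof (rule sum.cong[OF refl])
    fix p assume "p \<in> ?P"
    then obtain x z where p: "p = (x, z)" "x \<in> {1..?n}" "z \<in> {1..?n}"
      unfolding same_parity_pairs_def by auto
    then have "(x + z) div 2 \<in> {1..?n}" by auto
    then show "(if ?mono p then 4 else 0)
        = (case p of (x, z) \<Rightarrow> 1 + f x * f z + f ((x + z) div 2) * f x + f ((x + z) div 2) * f z)"
      using pm[of x] pm[of z] pm[of "(x + z) div 2"] p by auto
  qed
  also have "\<dots> = (\<Sum>(x, z)\<in>?P. 1) + (\<Sum>(x, z)\<in>?P. f x * f z)
      + (\<Sum>(x, z)\<in>?P. f ((x + z) div 2) * f x) + (\<Sum>(x, z)\<in>?P. f ((x + z) div 2) * f z)"
    by (simp add: case_prod_unfold sum.distrib)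
  also have "(\<Sum>(x, z)\<in>?P. 1) = 2 * (int h)\<^sup>2"
    by (simp only: sum_same_parity_pairs prod.case sum_parity_class) (simp add: power2_eq_square)
  also have "(\<Sum>(x, z)\<in>?P. f x * f z) = 0"
  proof -
    have "(\<Sum>z | z \<in> {1..?n} \<and> even (x + z). f z) = 0" for x
      using sum_odd_positions_eq_0[of h f, OF anti pairs] pairs
      unfolding sum_parity_class by (cases "even x") auto
    then show ?thesis
      by (simp add: sum_same_parity_pairs sum_distrib_left[symmetric])
  qed
  also have "(\<Sum>(x, z)\<in>?P. f ((x + z) div 2) * f z) = (\<Sum>(x, z)\<in>?P. f ((x + z) div 2) * f x)"
    by (rule sum.reindex_bij_witness[where i = prod.swap and j = prod.swap])
      (auto simp: same_parity_pairs_def add.commute)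
  also have "(\<Sum>(x, z)\<in>?P. f ((x + z) div 2) * f x) = 2 * ?S"
    by (rule sum_midpoint_products[of h f, OF anti])
  finally show ?thesis by simp
qed

section \<open>Colorings with block structure\<close>

lemma sum_blocks:
  fixes c :: "nat \<Rightarrow> int"
  assumes "m > 0" "s \<le> m"
  shows "(\<Sum>i<q * m + s. c (i div m)) = int m * (\<Sum>i<q. c i) + int s * c q"
proof -
  have partial: "(\<Sum>i<q * m + t. c (i div m)) = (\<Sum>i<q * m. c (i div m)) + int t * c q"
    if "t \<le> m" for q t
    using that by (induction t) (auto simp: algebra_simps)
  have "(\<Sum>i<q * m. c (i div m)) = int m * (\<Sum>i<q. c i)"
  proof (induction q)
    case (Suc q)
    then show ?case using partial[of m q] by (simp add: algebra_simps)
  qed simp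
  then show ?thesis using partial[OF assms(2)] by simp
qed

text \<open>
  While the midpoint crosses cell \<open>j\<close>, twice the midpoint crosses the cells \<open>2 * j\<close> and
  \<open>2 * j + 1\<close>, and the prefix sum is piecewise linear with its break at half the block. The
  combination of \<open>G\<close>-values is the trapezoidal rule on these two pieces; the term linear in \<open>k\<close>
  corrects for sampling at right ends.
\<close>
lemma sum_block_doubled_prefix:
  fixes c :: "nat \<Rightarrow> int"
  assumes k: "k > 0"
  defines "G \<equiv> \<lambda>q. \<Sum>i<q. c i"
  shows "(\<Sum>r<2 * k. \<Sum>i<2 * (j * (2 * k) + r) + 2. c (i div (2 * k)))
    = (int k)\<^sup>2 * (G (2 * j) + 2 * G (2 * j + 1) + G (2 * j + 2)) + int k * (c (2 * j) + c (2 * j + 1))"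
proof -
  define F where "F = (\<lambda>t. \<Sum>i<t. c (i div (2 * k)))"
  have lin: "(\<Sum>r<k. 2 * int k * a + (2 * int r + 2) * b) = 2 * (int k)\<^sup>2 * a + int k * (int k + 1) * b"
    for a b :: int
  proof -
    have "(\<Sum>r<n. 2 * int k * a + (2 * int r + 2) * b) = int n * (2 * int k * a) + int n * (int n + 1) * b"
      for n
      by (induction n) (auto simp: algebra_simps)
    then show ?thesis by (simp add: power2_eq_square)
  qed
  have split: "(\<Sum>r<m + n. g r) = (\<Sum>r<m. g r) + (\<Sum>r<n. g (m + r))"
    for m n and g :: "nat \<Rightarrow> int"
    by (induction n) (auto simp: add.assoc)
  have first: "F (2 * (j * (2 * k) + r) + 2) = 2 * int k * G (2 * j) + (2 * int r + 2) * c (2 * j)"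
    if "r < k" for r
    using sum_blocks[of "2 * k" "2 * r + 2" c "2 * j"] that k
    by (simp add: algebra_simps G_def F_def)
  have second: "F (2 * (j * (2 * k) + (k + r)) + 2)
      = 2 * int k * G (2 * j + 1) + (2 * int r + 2) * c (2 * j + 1)" if "r < k" for r
    using sum_blocks[of "2 * k" "2 * r + 2" c "2 * j + 1"] that k
    by (simp add: algebra_simps G_def F_def)
  have "(\<Sum>r<2 * k. F (2 * (j * (2 * k) + r) + 2))
      = (\<Sum>r<k. F (2 * (j * (2 * k) + r) + 2)) + (\<Sum>r<k. F (2 * (j * (2 * k) + (k + r)) + 2))"
    using split[of "\<lambda>r. F (2 * (j * (2 * k) + r) + 2)" k k] unfolding mult_2[of k] .
  also have "\<dots> = 2 * (int k)\<^sup>2 * (G (2 * j) + G (2 * j + 1))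
      + int k * (int k + 1) * (c (2 * j) + c (2 * j + 1))"
  proof -
    have "(\<Sum>r<k. F (2 * (j * (2 * k) + r) + 2)) = (\<Sum>r<k. 2 * int k * G (2 * j) + (2 * int r + 2) * c (2 * j))"
      by (rule sum.cong[OF refl], rule first) simp
    moreover have "(\<Sum>r<k. F (2 * (j * (2 * k) + (k + r)) + 2))
        = (\<Sum>r<k. 2 * int k * G (2 * j + 1) + (2 * int r + 2) * c (2 * j + 1))"
      by (rule sum.cong[OF refl], rule second) simp
    ultimately show ?thesis unfolding lin by (simp add: algebra_simps)
  qed
  also have "\<dots> = (int k)\<^sup>2 * (G (2 * j) + 2 * G (2 * j + 1) + G (2 * j + 2)) + int k * (c (2 * j) + c (2 * j + 1))"
    by (simp add: G_def algebra_simps power2_eq_square)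
  finally show ?thesis unfolding F_def .
qed

text \<open>
  Extending every window \<open>{1..<2 * y}\<close> by the position \<open>2 * y\<close> makes the block formula applicable
  and costs at most \<open>1\<close> per midpoint; the linear terms of the block formula cost at most
  \<open>2 * k\<close> per cell. Each of the two errors is at most the length \<open>l * (2 * k)\<close> of the left half.
\<close>
lemma sum_doubled_prefix_le:
  fixes c :: "nat \<Rightarrow> int"
  assumes k: "k > 0" and pm: "\<And>i. i < 2 * l \<Longrightarrow> c i = 1 \<or> c i = - 1"
  defines "f \<equiv> \<lambda>y. c ((y - 1) div (2 * k))" and "G \<equiv> \<lambda>q. \<Sum>i<q. c i"
  shows "(\<Sum>y\<in>{1..l * (2 * k)}. f y * (\<Sum>x\<in>{1..<2 * y}. f x))
    \<le> (int k)\<^sup>2 * (\<Sum>j<l. c j * (G (2 * j) + 2 * G (2 * j + 1) + G (2 * j + 2))) + 2 * int (l * (2 * k))"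
proof -
  let ?h = "l * (2 * k)"
  define F where "F = (\<lambda>t. \<Sum>i<t. c (i div (2 * k)))"
  have pm_div: "c (i div (2 * k)) = 1 \<or> c (i div (2 * k)) = - 1" if "i < 2 * ?h" for i
    using that k by (intro pm) (simp add: less_mult_imp_div_less)
  have "(\<Sum>y\<in>{1..?h}. f y * (\<Sum>x\<in>{1..<2 * y}. f x))
      = (\<Sum>i<?h. c (i div (2 * k)) * F (2 * i + 1))"
  proof -
    have "(\<Sum>x\<in>{1..<2 * Suc i}. f x) = F (2 * i + 1)" for i
      unfolding F_def f_def
      by (rule sum.reindex_bij_witness[where i = Suc and j = "\<lambda>x. x - 1"]) auto
    moreover have "f (Suc i) = c (i div (2 * k))" for i by (simp add: f_def)
    ultimately show ?thesis by (simp only: One_nat_def sum.atLeast1_atMost_eq)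
  qed
  also have "\<dots> \<le> (\<Sum>i<?h. c (i div (2 * k)) * F (2 * i + 2) + 1)"
  proof (rule sum_mono)
    fix i assume "i \<in> {..<?h}"
    then show "c (i div (2 * k)) * F (2 * i + 1) \<le> c (i div (2 * k)) * F (2 * i + 2) + 1"
      using pm_div[of i] pm_div[of "2 * i + 1"] by (auto simp: F_def)
  qed
  also have "\<dots> = (\<Sum>i<?h. c (i div (2 * k)) * F (2 * i + 2)) + int ?h"
    by (simp add: sum.distrib)
  also have "(\<Sum>i<?h. c (i div (2 * k)) * F (2 * i + 2))
      = (\<Sum>j<l. \<Sum>i\<in>{j * (2 * k)..<j * (2 * k) + 2 * k}. c (i div (2 * k)) * F (2 * i + 2))"
    by (rule sum.nat_group[symmetric])
  also have "\<dots> = (\<Sum>j<l. c j * (\<Sum>r<2 * k. F (2 * (j * (2 * k) + r) + 2)))"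
  proof (rule sum.cong[OF refl])
    fix j
    let ?I = "{j * (2 * k)..<j * (2 * k) + 2 * k}"
    have "i div (2 * k) = j" if "i \<in> ?I" for i
      using that by (intro div_nat_eqI) (auto simp: algebra_simps)
    then have "(\<Sum>i\<in>?I. c (i div (2 * k)) * F (2 * i + 2)) = (\<Sum>i\<in>?I. c j * F (2 * i + 2))"
      by (intro sum.cong refl) simp
    also have "\<dots> = c j * (\<Sum>r<2 * k. F (2 * (j * (2 * k) + r) + 2))"
      unfolding sum_distrib_left
      by (rule sum.reindex_bij_witness[where i = "\<lambda>r. j * (2 * k) + r" and j = "\<lambda>i. i - j * (2 * k)"])
        auto
    finally show "(\<Sum>i\<in>?I. c (i div (2 * k)) * F (2 * i + 2))
        = c j * (\<Sum>r<2 * k. F (2 * (j * (2 * k) + r) + 2))" .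
  qed
  also have "\<dots> = (int k)\<^sup>2 * (\<Sum>j<l. c j * (G (2 * j) + 2 * G (2 * j + 1) + G (2 * j + 2)))
      + int k * (\<Sum>j<l. c j * (c (2 * j) + c (2 * j + 1)))"
  proof -
    have "(\<Sum>r<2 * k. F (2 * (j * (2 * k) + r) + 2))
        = (int k)\<^sup>2 * (G (2 * j) + 2 * G (2 * j + 1) + G (2 * j + 2)) + int k * (c (2 * j) + c (2 * j + 1))" for j
      unfolding F_def G_def by (rule sum_block_doubled_prefix[OF k])
    moreover have "a * (p * x + q * y) = p * (a * x) + q * (a * y)" for a p q x y :: int
      by (simp add: algebra_simps)
    ultimately have "(\<Sum>j<l. c j * (\<Sum>r<2 * k. F (2 * (j * (2 * k) + r) + 2)))
        = (\<Sum>j<l. (int k)\<^sup>2 * (c j * (G (2 * j) + 2 * G (2 * j + 1) + G (2 * j + 2)))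
          + int k * (c j * (c (2 * j) + c (2 * j + 1))))"
      by presburger
    also have "\<dots> = (\<Sum>j<l. (int k)\<^sup>2 * (c j * (G (2 * j) + 2 * G (2 * j + 1) + G (2 * j + 2))))
        + (\<Sum>j<l. int k * (c j * (c (2 * j) + c (2 * j + 1))))"
      by (rule sum.distrib)
    finally show ?thesis by (simp only: sum_distrib_left)
  qed
  also have "int k * (\<Sum>j<l. c j * (c (2 * j) + c (2 * j + 1))) \<le> int k * (\<Sum>j<l. 2)"
  proof (intro mult_left_mono sum_mono)
    fix j assume "j \<in> {..<l}"
    then show "c j * (c (2 * j) + c (2 * j + 1)) \<le> 2"
      using pm[of j] pm[of "2 * j"] pm[of "2 * j + 1"] by auto
  qed simp
  finally show ?thesis by (simp add: mult.commute add.commute)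
qed

lemma V_le_card_mono_aps: "\<chi> \<in> colorings n \<Longrightarrow> V n \<le> card (mono_aps n \<chi>)"
  unfolding V_def by (intro Min_le) (auto simp: finite_colorings)

text \<open>
  The error \<open>2 * h\<close> from \<open>sum_doubled_prefix_le\<close>, doubled, is exactly the term \<open>4 * h\<close> that stands
  for the degenerate triples in \<open>card_mono_aps_antisymmetric\<close>, so the lower-order terms cancel.
\<close>
lemma V_block_le:
  fixes c :: "nat \<Rightarrow> int"
  assumes k: "k > 0" and pm: "\<And>i. i < 2 * l \<Longrightarrow> c i = 1 \<or> c i = - 1"
    and anti: "\<And>i. i < 2 * l \<Longrightarrow> c (2 * l - 1 - i) = - c i"
  defines "G \<equiv> \<lambda>q. \<Sum>i<q. c i"
  shows "2 * int (V (4 * l * k))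
    \<le> (int k)\<^sup>2 * (2 * (int l)\<^sup>2 + (\<Sum>j<l. c j * (G (2 * j) + 2 * G (2 * j + 1) + G (2 * j + 2))))"
proof -
  define f where "f = (\<lambda>y. c ((y - 1) div (2 * k)))"
  define h where "h = l * (2 * k)"
  have blk: "(i - 1) div (2 * k) < 2 * l" if "i \<in> {1..2 * h}" for i
    using that k unfolding h_def by (intro less_mult_imp_div_less) auto
  have f_anti: "f (2 * h + 1 - i) = - f i" if i: "i \<in> {1..2 * h}" for i
  proof -
    define q r where "q = (i - 1) div (2 * k)" and "r = (i - 1) mod (2 * k)"
    have q: "q < 2 * l" using blk[OF i] unfolding q_def .
    have r: "r < 2 * k" using k unfolding r_def by simp
    have "i - 1 = q * (2 * k) + r" unfolding q_def r_def by (simp only: div_mult_mod_eq)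
    moreover have "2 * h = (2 * l - 1 - q) * (2 * k) + q * (2 * k) + 2 * k"
    proof -
      have "2 * h = (2 * l) * (2 * k)" unfolding h_def by simp
      also have "2 * l = (2 * l - 1 - q) + q + 1" using q by simp
      finally show ?thesis by (simp only: add_mult_distrib mult_1)
    qed
    ultimately have *: "2 * h + 1 - i - 1 = (2 * l - 1 - q) * (2 * k) + (2 * k - 1 - r)"
      using i r by auto
    have "(a * (2 * k) + b) div (2 * k) = a" if "b < 2 * k" for a b
      using that by simp
    moreover have "2 * k - 1 - r < 2 * k" using k by simp
    ultimately have "(2 * h + 1 - i - 1) div (2 * k) = 2 * l - 1 - q"
      unfolding * .
    then show ?thesis using anti[OF q] unfolding f_def q_def by simp
  qed
  have f_pairs: "f (2 * i + 1) = f (2 * i + 2)" for i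
  proof -
    have "(2 * i + 1) div (2 * k) = (2 * i) div (2 * k)" by (simp add: div_mult2_eq)
    then show ?thesis unfolding f_def by simp
  qed
  have n: "2 * h = 4 * l * k" unfolding h_def by simp
  have "4 * int (V (2 * h)) + 4 * int h
      \<le> 4 * int (card (mono_aps (2 * h) (sign_coloring (2 * h) f))) + 4 * int h"
    using V_le_card_mono_aps[OF sign_coloring_in_colorings] by simp
  also have "\<dots> = (int h)\<^sup>2 + 2 * (\<Sum>y\<in>{1..h}. f y * (\<Sum>x\<in>{1..<2 * y}. f x))"
    using pm[OF blk] by (intro card_mono_aps_antisymmetric f_anti f_pairs) (auto simp: f_def)
  also have "\<dots> \<le> (int h)\<^sup>2 + 2 * ((int k)\<^sup>2 * (\<Sum>j<l. c j * (G (2 * j) + 2 * G (2 * j + 1) + G (2 * j + 2))) + 2 * int h)"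
    using sum_doubled_prefix_le[of k l c, OF k pm] unfolding f_def h_def G_def by simp
  finally have "2 * int (V (2 * h)) \<le> (int k)\<^sup>2 * (\<Sum>j<l. c j * (G (2 * j) + 2 * G (2 * j + 1) + G (2 * j + 2))) + 2 * (int k)\<^sup>2 * (int l)\<^sup>2"
    unfolding h_def by (simp add: algebra_simps power2_eq_square)
  then show ?thesis unfolding n by (simp add: algebra_simps)
qed

section \<open>The twelve-block pattern\<close>

definition left_half :: "int list" where
  "left_half = concat [replicate 28 1, replicate 6 (- 1), replicate 28 1,
     replicate 37 (- 1), replicate 59 1, replicate 116 (- 1)]"

definition pattern :: "int list" where
  "pattern = left_half @ map uminus (rev left_half)"

lemma length_left_half: "length left_half = 274"
  unfolding left_half_def by simp

lemma pattern_sign: "i < 548 \<Longrightarrow> pattern ! i = 1 \<or> pattern ! i = - 1"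
proof -
  have *: "set left_half \<subseteq> {1, - 1}" unfolding left_half_def by auto
  have "set pattern \<subseteq> {1, - 1}" using * unfolding pattern_def by force
  moreover assume "i < 548"
  then have "pattern ! i \<in> set pattern"
    by (intro nth_mem) (simp add: pattern_def length_left_half)
  ultimately show ?thesis by auto
qed

lemma pattern_antisymmetric: "i < 548 \<Longrightarrow> pattern ! (547 - i) = - pattern ! i"
  unfolding pattern_def by (auto simp: nth_append length_left_half rev_nth)

text \<open>
  The pattern sum of \<open>V_block_le\<close>, as a single pass over the lists that carries the current prefix
  sum in its last argument, so that it can be computed by rewriting: one sign of the midpoint list
  is consumed for every two signs of the endpoint list. With prefix sum \<open>s\<close>, the trapezoidal
  weight \<open>s + 2 * (s + b) + (s + b + b')\<close> is \<open>4 * s + 3 * b + b'\<close>.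
\<close>
fun weighted_sum :: "int list \<Rightarrow> int list \<Rightarrow> int \<Rightarrow> int" where
  "weighted_sum (a # as) (b # b' # bs) s
     = a * (4 * s + 3 * b + b') + weighted_sum as bs (s + b + b')"
| "weighted_sum _ _ s = 0"

lemma weighted_sum_eq:
  assumes "length bs \<ge> 2 * length as"
  defines "G \<equiv> \<lambda>q. \<Sum>i<q. bs ! i"
  shows "weighted_sum as bs s
    = (\<Sum>j<length as. as ! j * (4 * s + (G (2 * j) + 2 * G (2 * j + 1) + G (2 * j + 2))))"
  using assms(1) unfolding G_def
proof (induction as bs s rule: weighted_sum.induct)
  case (1 a as b b' bs s)
  then show ?case
    by (simp add: sum.lessThan_Suc_shift algebra_simps del: sum.lessThan_Suc)
next
  case ("2_3" as b s)
  then have "as = []" by (cases as) auto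
  then show ?case by simp
qed auto

lemma weighted_sum_pattern: "weighted_sum left_half pattern 0 = - 21920"
  by code_simp

text \<open>A blow-up with blocks of even length \<open>2 * k\<close> of the \<open>548\<close> cells has length \<open>1096 * k\<close>.\<close>
lemma V_1096_le:
  assumes "k > 0"
  shows "V (1096 * k) \<le> 64116 * k\<^sup>2"
proof -
  define G where "G = (\<lambda>q. \<Sum>i<q. pattern ! i)"
  have "(\<Sum>j<274. pattern ! j * (G (2 * j) + 2 * G (2 * j + 1) + G (2 * j + 2)))
      = weighted_sum left_half pattern 0"
    by (subst weighted_sum_eq)
      (auto simp: pattern_def length_left_half nth_append G_def intro!: sum.cong)
  then have "2 * int (V (1096 * k)) \<le> (int k)\<^sup>2 * (2 * 274\<^sup>2 - 21920)"
    using V_block_le[of k 274 "\<lambda>i. pattern ! i"] assms pattern_sign pattern_antisymmetric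
    unfolding G_def weighted_sum_pattern by simp
  then have "int (V (1096 * k)) \<le> int (64116 * k\<^sup>2)" by simp
  then show ?thesis by linarith
qed

section \<open>All lengths\<close>

text \<open>An optimal coloring of the longer interval can be restricted to the shorter one.\<close>
lemma V_mono:
  assumes "n \<le> n'"
  shows "V n \<le> V n'"
proof -
  have "V n' \<in> (\<lambda>\<chi>. card (mono_aps n' \<chi>)) ` colorings n'"
    unfolding V_def by (rule Min_in) (auto simp: finite_colorings colorings_nonempty)
  then obtain \<chi> where \<chi>: "\<chi> \<in> colorings n'" "V n' = card (mono_aps n' \<chi>)" by auto
  have "restrict \<chi> {1..n} \<in> colorings n"
    using \<chi>(1) assms unfolding colorings_def by (auto simp: PiE_iff)
  then have "V n \<le> card (mono_aps n (restrict \<chi> {1..n}))" by (rule V_le_card_mono_aps)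
  also have "\<dots> \<le> card (mono_aps n' \<chi>)"
  proof (rule card_mono)
    show "finite (mono_aps n' \<chi>)"
      by (rule finite_subset[OF _ finite_three_aps[of n']]) (auto simp: mono_aps_def)
    show "mono_aps n (restrict \<chi> {1..n}) \<subseteq> mono_aps n' \<chi>"
      using assms by (fastforce simp: mono_aps_def three_aps_def)
  qed
  finally show ?thesis using \<chi>(2) by simp
qed

theorem theorem5:
  shows "\<exists>\<epsilon> :: nat \<Rightarrow> real. \<epsilon> \<longlonglongrightarrow> 0 \<and>
    (\<forall>n \<ge> 1. real (V n) \<le> 117 / 2192 * (real n)\<^sup>2 * (1 + \<epsilon> n))"
proof (intro exI conjI allI impI)
  let ?\<epsilon> = "\<lambda>n::nat. (1 + 1096 * (1 / real n))\<^sup>2 - 1"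
  have "?\<epsilon> \<longlonglongrightarrow> (1 + 1096 * 0)\<^sup>2 - 1"
    by (intro tendsto_intros lim_1_over_n)
  then show "?\<epsilon> \<longlonglongrightarrow> 0" by simp
  fix n :: nat assume n: "n \<ge> 1"
  \<comment> \<open>\<open>1096 * k\<close> is the least multiple of \<open>1096\<close> above \<open>n\<close>.\<close>
  define k where "k = n div 1096 + 1"
  have "n \<le> 1096 * k" "1096 * k \<le> n + 1096"
    using div_mult_mod_eq[of n 1096] mod_less_divisor[of 1096 n] unfolding k_def by auto
  have "V n \<le> V (1096 * k)" using \<open>n \<le> 1096 * k\<close> by (rule V_mono)
  also have "\<dots> \<le> 64116 * k\<^sup>2" by (rule V_1096_le) (simp add: k_def)
  finally have "real (V n) \<le> real (64116 * k\<^sup>2)" by (simp only: of_nat_le_iff)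
  also have "\<dots> = 117 / 2192 * (real (1096 * k))\<^sup>2"
    by (simp add: power_mult_distrib)
  also have "\<dots> \<le> 117 / 2192 * (real (n + 1096))\<^sup>2"
    using \<open>1096 * k \<le> n + 1096\<close> by (intro mult_left_mono power_mono) (simp only: of_nat_le_iff, simp_all)
  also have "real (n + 1096) = real n * (1 + 1096 * (1 / real n))"
    using n by (simp add: field_simps)
  finally show "real (V n) \<le> 117 / 2192 * (real n)\<^sup>2 * (1 + ?\<epsilon> n)"
    by (simp add: power_mult_distrib)
qed

end
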